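(* Let $(A,\mu,\alpha,\beta)$ be a left BiHom-alternative algebra over a field $\mathbb{K}$ of characteristic $0$, and let $d_t=\sum_{i\ge 0}d_it^i$ be a one-parameter formal deformation of it. Let $d_p$ ($p\ge 1$) be the first non-zero coefficient after $d_0=\mu$, i.e. $d_1=\cdots=d_{p-1}=0$ and $d_p\ne 0$. Then $d_p$ is a $2$-cocycle of the left BiHom-alternative algebra cohomology of $A$ with coefficients in itself, i.e. $d_p\in Z^2_{\alpha,\beta}(A;A)$.
   Context: Write $xy=\mu(x,y)$. A left BiHom-alternative algebra $(A,\mu,\alpha,\beta)$ is a $\mathbb{K}$-vector space $A$ with a bilinear map $\mu:A\times A\to A$ and linear maps $\alpha,\beta:A\to A$ such that $\alpha\beta=\beta\alpha$, $\alpha(xy)=\alpha(x)\alpha(y)$, $\beta(xy)=\beta(x)\beta(y)$, and for all $x,y,z\in A$ $$as_{\alpha,\beta}(\beta(x),\alpha(y),z)+as_{\alpha,\beta}(\beta(y),\alpha(x),z)=0,$$ where $as_{\alpha,\beta}(x,y,z)=(xy)\beta(z)-\alpha(x)(yz)$. A one-parameter formal deformation of $(A,\mu,\alpha,\beta)$ is a formal power series $d_t=\sum_{i\ge0}d_it^i$, where each $d_i:A\times A\to A$ is $\mathbb{K}$-bilinear (extended $\mathbb{K}[[t]]$-bilinearly to $A[[t]]$; $\alpha,\beta$ are extended $\mathbb{K}[[t]]$-linearly) and $d_0=\mu$, such that $d_t(\alpha(x),\alpha(y))=\alpha(d_t(x,y))$, $d_t(\beta(x),\beta(y))=\beta(d_t(x,y))$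 and $$d_t(d_t(\beta(x),\alpha(y)),\beta(z))-d_t(\alpha\beta(x),d_t(\alpha(y),z))+d_t(d_t(\beta(y),\alpha(x)),\beta(z))-d_t(\alpha\beta(y),d_t(\alpha(x),z))=0.$$ $C^2_{\alpha,\beta}(A;A)$ is the space of bilinear maps $f:A\times A\to A$ with $\alpha f(x,y)=f(\alpha(x),\alpha(y))$ and $\beta f(x,y)=f(\beta(x),\beta(y))$. For $f\in C^2_{\alpha,\beta}(A;A)$, $$\delta^2f(x,y,z)=f(\beta(x),\alpha(y))\beta(z)-\alpha\beta(x)f(\alpha(y),z)+f(\beta(y),\alpha(x))\beta(z)-\alpha\beta(y)f(\alpha(x),z)$$ $$\qquad+f(\beta(x)\alpha(y),\beta(z))-f(\alpha\beta(x),\alpha(y)z)+f(\beta(y)\alpha(x),\beta(z))-f(\alpha\beta(y),\alpha(x)z),$$ and $Z^2_{\alpha,\beta}(A;A)=\{f\in C^2_{\alpha,\beta}(A;A):\delta^2f=0\}$. *)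

theory Defs
  imports "HOL-Computational_Algebra.Formal_Power_Series"
begin

definition bilinear_map ::
  "('k::field \<Rightarrow> 'a::ab_group_add \<Rightarrow> 'a) \<Rightarrow> ('a \<Rightarrow> 'a \<Rightarrow> 'a) \<Rightarrow> bool" where
  "bilinear_map scale f \<longleftrightarrow>
     (\<forall>x. Vector_Spaces.linear scale scale (\<lambda>y. f x y)) \<and>
     (\<forall>y. Vector_Spaces.linear scale scale (\<lambda>x. f x y))"

definition bihom_associator ::
  "('a::ab_group_add \<Rightarrow> 'a \<Rightarrow> 'a) \<Rightarrow> ('a \<Rightarrow> 'a) \<Rightarrow> ('a \<Rightarrow> 'a) \<Rightarrow> 'a \<Rightarrow> 'a \<Rightarrow> 'a \<Rightarrow> 'a" where
  "bihom_associator \<mu> \<alpha> \<beta> x y z = \<mu> (\<mu> x y) (\<beta> z) - \<mu> (\<alpha> x) (\<mu> y z)"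

locale left_bihom_alternative_algebra = vector_space scale
  for scale :: "'k::field \<Rightarrow> 'a::ab_group_add \<Rightarrow> 'a" +
  fixes \<mu> :: "'a \<Rightarrow> 'a \<Rightarrow> 'a" and \<alpha> \<beta> :: "'a \<Rightarrow> 'a"
  assumes bilinear_mu: "bilinear_map scale \<mu>"
    and linear_alpha: "Vector_Spaces.linear scale scale \<alpha>"
    and linear_beta: "Vector_Spaces.linear scale scale \<beta>"
    and alpha_beta_commute: "\<alpha> \<circ> \<beta> = \<beta> \<circ> \<alpha>"
    and alpha_mult: "\<alpha> (\<mu> x y) = \<mu> (\<alpha> x) (\<alpha> y)"
    and beta_mult: "\<beta> (\<mu> x y) = \<mu> (\<beta> x) (\<beta> y)"
    and left_alternative:
      "bihom_associator \<mu> \<alpha> \<beta> (\<beta> x) (\<alpha> y) z + bihom_associator \<mu> \<alpha> \<beta> (\<beta> y) (\<alpha> x) z = 0"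

text \<open>
  The module \<open>A[[t]]\<close> is the type \<open>'a fps\<close>, with \<open>A\<close> embedded in it by \<^const>\<open>fps_const\<close>.
  A series \<open>d\<^sub>t = \<Sum>\<^sub>i d\<^sub>i t\<^sup>i\<close> of bilinear maps is given by its sequence of coefficients, and
  \<open>fps_bilinear_ext d\<close> is its \<open>K[[t]]\<close>-bilinear extension to \<open>A[[t]]\<close>. The extensions below
  are the only \<open>K[[t]]\<close>-linear ones, since multiples of \<open>t\<^sup>n\<close> go to multiples of \<open>t\<^sup>n\<close>.
\<close>

definition fps_linear_ext :: "('a::zero \<Rightarrow> 'a) \<Rightarrow> 'a fps \<Rightarrow> 'a fps" where
  "fps_linear_ext f F = Abs_fps (\<lambda>n. f (fps_nth F n))"

definition fps_bilinear_ext ::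
  "(nat \<Rightarrow> 'a::ab_group_add \<Rightarrow> 'a \<Rightarrow> 'a) \<Rightarrow> 'a fps \<Rightarrow> 'a fps \<Rightarrow> 'a fps" where
  "fps_bilinear_ext d F G =
     Abs_fps (\<lambda>n. \<Sum>i\<le>n. \<Sum>j\<le>n - i. d i (fps_nth F j) (fps_nth G (n - i - j)))"

definition formal_deformation ::
  "('k::field \<Rightarrow> 'a::ab_group_add \<Rightarrow> 'a) \<Rightarrow> ('a \<Rightarrow> 'a \<Rightarrow> 'a) \<Rightarrow> ('a \<Rightarrow> 'a) \<Rightarrow> ('a \<Rightarrow> 'a) \<Rightarrow>
   (nat \<Rightarrow> 'a \<Rightarrow> 'a \<Rightarrow> 'a) \<Rightarrow> bool" where
  "formal_deformation scale \<mu> \<alpha> \<beta> d \<longleftrightarrow>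
     (let D = fps_bilinear_ext d; a = fps_linear_ext \<alpha>; b = fps_linear_ext \<beta>; c = fps_const in
       (\<forall>i. bilinear_map scale (d i)) \<and> d 0 = \<mu> \<and>
       (\<forall>x y. D (a (c x)) (a (c y)) = a (D (c x) (c y))) \<and>
       (\<forall>x y. D (b (c x)) (b (c y)) = b (D (c x) (c y))) \<and>
       (\<forall>x y z.
          D (D (b (c x)) (a (c y))) (b (c z)) - D (a (b (c x))) (D (a (c y)) (c z))
        + D (D (b (c y)) (a (c x))) (b (c z)) - D (a (b (c y))) (D (a (c x)) (c z)) = 0))"

definition C2 ::
  "('k::field \<Rightarrow> 'a::ab_group_add \<Rightarrow> 'a) \<Rightarrow> ('a \<Rightarrow> 'a) \<Rightarrow> ('a \<Rightarrow> 'a) \<Rightarrow> ('a \<Rightarrow> 'a \<Rightarrow> 'a) set" where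
  "C2 scale \<alpha> \<beta> = {f. bilinear_map scale f \<and>
     (\<forall>x y. \<alpha> (f x y) = f (\<alpha> x) (\<alpha> y)) \<and> (\<forall>x y. \<beta> (f x y) = f (\<beta> x) (\<beta> y))}"

definition delta2 ::
  "('a::ab_group_add \<Rightarrow> 'a \<Rightarrow> 'a) \<Rightarrow> ('a \<Rightarrow> 'a) \<Rightarrow> ('a \<Rightarrow> 'a) \<Rightarrow> ('a \<Rightarrow> 'a \<Rightarrow> 'a) \<Rightarrow>
   'a \<Rightarrow> 'a \<Rightarrow> 'a \<Rightarrow> 'a" where
  "delta2 \<mu> \<alpha> \<beta> f x y z =
     \<mu> (f (\<beta> x) (\<alpha> y)) (\<beta> z) - \<mu> (\<alpha> (\<beta> x)) (f (\<alpha> y) z)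
   + \<mu> (f (\<beta> y) (\<alpha> x)) (\<beta> z) - \<mu> (\<alpha> (\<beta> y)) (f (\<alpha> x) z)
   + f (\<mu> (\<beta> x) (\<alpha> y)) (\<beta> z) - f (\<alpha> (\<beta> x)) (\<mu> (\<alpha> y) z)
   + f (\<mu> (\<beta> y) (\<alpha> x)) (\<beta> z) - f (\<alpha> (\<beta> y)) (\<mu> (\<alpha> x) z)"

definition Z2 ::
  "('k::field \<Rightarrow> 'a::ab_group_add \<Rightarrow> 'a) \<Rightarrow> ('a \<Rightarrow> 'a \<Rightarrow> 'a) \<Rightarrow> ('a \<Rightarrow> 'a) \<Rightarrow> ('a \<Rightarrow> 'a) \<Rightarrow>
   ('a \<Rightarrow> 'a \<Rightarrow> 'a) set" where
  "Z2 scale \<mu> \<alpha> \<beta> = {f \<in> C2 scale \<alpha> \<beta>. \<forall>x y z. delta2 \<mu> \<alpha> \<beta> f x y z = 0}"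

end

theory Submission
  imports Defs
begin

text \<open>
  The coefficient of \<open>t\<^sup>p\<close> in a composite of two copies of \<open>d\<^sub>t\<close> is a sum over \<open>i + j = p\<close>, of which
  only the terms with \<open>{i, j} = {0, p}\<close> survive. Hence the coefficient of \<open>t\<^sup>p\<close> in the deformation
  equation is \<open>\<delta>\<^sup>2 d\<^sub>p\<close>.
\<close>

lemma bilinear_map_zero:
  assumes "bilinear_map scale f"
  shows "f 0 y = 0" and "f x 0 = 0"
proof -
  have "Vector_Spaces.linear scale scale (\<lambda>x. f x y)" "Vector_Spaces.linear scale scale (f x)"
    using assms by (auto simp: bilinear_map_def)
  then show "f 0 y = 0" "f x 0 = 0"
    by (auto dest: module_hom.zero simp: Vector_Spaces.linear_iff_module_hom)
qed

lemma fps_linear_ext_const: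
  assumes "f 0 = 0"
  shows "fps_linear_ext f (fps_const x) = fps_const (f x)"
  using assms by (simp add: fps_linear_ext_def fps_eq_iff)

text \<open>A constant series has no coefficients in positive degree and \<open>d i\<close> vanishes
  at \<open>0\<close>, so only \<open>j = m\<close> survives in the inner convolution. This
  evaluates the composites \<open>D (D x y) z\<close>, whose first argument is a genuine
  series.\<close>

lemma fps_bilinear_ext_const_right_nth:
  assumes "\<And>i x. d i x 0 = 0"
  shows "fps_nth (fps_bilinear_ext d F (fps_const z)) n = (\<Sum>i\<le>n. d i (fps_nth F (n - i)) z)"
proof -
  have "(\<Sum>j\<le>m. d i (fps_nth F j) (fps_nth (fps_const z) (m - j))) = d i (fps_nth F m) z" for i m
  proof -
    have "(\<Sum>j\<le>m. d i (fps_nth F j) (fps_nth (fps_const z) (m - j)))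
        = (\<Sum>j\<le>m. if j = m then d i (fps_nth F j) z else 0)"
      by (rule sum.cong) (auto simp: assms)
    then show ?thesis by simp
  qed
  then show ?thesis by (simp only: fps_bilinear_ext_def fps_nth_Abs_fps)
qed

lemma fps_bilinear_ext_const_left_nth:
  assumes "\<And>i y. d i 0 y = 0"
  shows "fps_nth (fps_bilinear_ext d (fps_const x) G) n = (\<Sum>i\<le>n. d i x (fps_nth G (n - i)))"
proof -
  have "(\<Sum>j\<le>m. d i (fps_nth (fps_const x) j) (fps_nth G (m - j))) = d i x (fps_nth G m)" for i m
  proof -
    have "(\<Sum>j\<le>m. d i (fps_nth (fps_const x) j) (fps_nth G (m - j)))
        = (\<Sum>j\<le>m. if j = 0 then d i x (fps_nth G (m - j)) else 0)"
      by (rule sum.cong) (auto simp: assms)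
    then show ?thesis by simp
  qed
  then show ?thesis by (simp only: fps_bilinear_ext_def fps_nth_Abs_fps)
qed

lemma fps_bilinear_ext_const_const_nth:
  assumes "\<And>i y. d i 0 y = 0" and "\<And>i x. d i x 0 = 0"
  shows "fps_nth (fps_bilinear_ext d (fps_const x) (fps_const y)) n = d n x y"
proof -
  have "(\<Sum>i\<le>n. d i x (fps_nth (fps_const y) (n - i))) = (\<Sum>i\<le>n. if i = n then d i x y else 0)"
    by (rule sum.cong) (auto simp: assms)
  then show ?thesis by (simp add: fps_bilinear_ext_const_left_nth assms)
qed

text \<open>The bound \<open>p \<ge> 1\<close> makes \<open>0\<close> and \<open>p\<close> distinct,
  so that the two surviving terms do not collapse into one.\<close>

lemma sum_atMost_endpoints:
  fixes f :: "nat \<Rightarrow> 'a::comm_monoid_add"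
  assumes "p \<ge> 1" and "\<And>i. 1 \<le> i \<Longrightarrow> i < p \<Longrightarrow> f i = 0"
  shows "(\<Sum>i\<le>p. f i) = f 0 + f p"
proof -
  have "(\<Sum>i\<le>p. f i) = (\<Sum>i\<in>{0, p}. f i)"
    by (rule sum.mono_neutral_right) (use assms in auto)
  then show ?thesis using assms(1) by simp
qed

theorem theorem3p1:
  fixes scale :: "'k::field_char_0 \<Rightarrow> 'a::ab_group_add \<Rightarrow> 'a"
    and \<mu> :: "'a \<Rightarrow> 'a \<Rightarrow> 'a"
    and \<alpha> \<beta> :: "'a \<Rightarrow> 'a"
    and d :: "nat \<Rightarrow> 'a \<Rightarrow> 'a \<Rightarrow> 'a"
    and p :: nat
  assumes "left_bihom_alternative_algebra scale \<mu> \<alpha> \<beta>"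
    and "formal_deformation scale \<mu> \<alpha> \<beta> d"
    and "p \<ge> 1"
    and "\<forall>i. 1 \<le> i \<and> i < p \<longrightarrow> d i = (\<lambda>x y. 0)"
    and "d p \<noteq> (\<lambda>x y. 0)"
  shows "d p \<in> Z2 scale \<mu> \<alpha> \<beta>"
proof -
  interpret left_bihom_alternative_algebra scale \<mu> \<alpha> \<beta> by fact
  let ?D = "fps_bilinear_ext d" and ?a = "fps_linear_ext \<alpha>" and ?b = "fps_linear_ext \<beta>"
  let ?c = "fps_const :: 'a \<Rightarrow> 'a fps"
  have bil: "\<And>i. bilinear_map scale (d i)"
    and d0: "d 0 = \<mu>"
    and Da: "\<And>x y. ?D (?a (?c x)) (?a (?c y)) = ?a (?D (?c x) (?c y))"
    and Db: "\<And>x y. ?D (?b (?c x)) (?b (?c y)) = ?b (?D (?c x) (?c y))"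
    and DD: "\<And>x y z. ?D (?D (?b (?c x)) (?a (?c y))) (?b (?c z)) - ?D (?a (?b (?c x))) (?D (?a (?c y)) (?c z))
        + ?D (?D (?b (?c y)) (?a (?c x))) (?b (?c z)) - ?D (?a (?b (?c y))) (?D (?a (?c x)) (?c z)) = 0"
    using assms(2) by (simp_all add: formal_deformation_def Let_def)
  note d_zero = bilinear_map_zero[OF bil]
  have "\<alpha> 0 = 0" "\<beta> 0 = 0"
    using linear_alpha linear_beta
    by (auto dest: module_hom.zero simp: Vector_Spaces.linear_iff_module_hom)
  then have const: "?a (?c x) = ?c (\<alpha> x)" "?b (?c x) = ?c (\<beta> x)" for x
    by (simp_all add: fps_linear_ext_const)
  \<comment> \<open>On constants, the coefficient of \<open>t^n\<close> in the extension of
    \<open>d\<close> is \<open>d n\<close> itself.\<close>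
  note nth = fps_bilinear_ext_const_const_nth[of d, OF d_zero]
  have \<alpha>: "\<alpha> (d p x y) = d p (\<alpha> x) (\<alpha> y)" for x y
    using arg_cong[OF Da[of x y], of "\<lambda>F. fps_nth F p"]
    \<comment> \<open>The maps applied to constants are evaluated first. The outer one acts on the
      non-constant series \<open>?D (?c x) (?c y)\<close>, so it is then unfolded and acts
      coefficientwise.\<close>
    by (simp add: const nth) (simp add: fps_linear_ext_def nth)
  have \<beta>: "\<beta> (d p x y) = d p (\<beta> x) (\<beta> y)" for x y
    using arg_cong[OF Db[of x y], of "\<lambda>F. fps_nth F p"]
    by (simp add: const nth) (simp add: fps_linear_ext_def nth)
  \<comment> \<open>The coefficient is the sum over \<open>i \<le> p\<close> of
    \<open>d i (d (p - i) x y) z\<close>. For \<open>0 < i < p\<close> the outer \<open>d i\<close>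
    is zero; \<open>i = 0\<close> and \<open>i = p\<close> give the two terms, with
    \<open>d 0 = \<mu>\<close>.\<close>
  have left: "fps_nth (?D (?D (?c x) (?c y)) (?c z)) p = \<mu> (d p x y) z + d p (\<mu> x y) z" for x y z
    using assms(3,4)
    by (simp add: fps_bilinear_ext_const_right_nth d_zero nth sum_atMost_endpoints d0)
  have right: "fps_nth (?D (?c x) (?D (?c y) (?c z))) p = \<mu> x (d p y z) + d p x (\<mu> y z)" for x y z
    using assms(3,4)
    by (simp add: fps_bilinear_ext_const_left_nth[of d] d_zero nth sum_atMost_endpoints d0)
  \<comment> \<open>Each of the four composites in the deformation equation contributes two terms in
    degree \<open>p\<close>; together they are the eight terms of \<open>delta2\<close>, up to
    order.\<close>
  have "delta2 \<mu> \<alpha> \<beta> (d p) x y z = 0" for x y z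
    using arg_cong[OF DD[of x y z], of "\<lambda>F. fps_nth F p"]
    by (simp add: const left right delta2_def algebra_simps)
  with bil \<alpha> \<beta> show ?thesis by (simp add: Z2_def C2_def)
qed

end
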